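(* Let $\mathbf{u}\in\mathcal{P}'$ be a classical functional, so that $D(\phi\mathbf{u})=\psi\mathbf{u}$, where $\phi(x)=ax^2+bx+c$ and $\psi(x)=px+q$ with $a,b,c,p,q\in\mathbb{C}$, subject to the regularity conditions $$na+p\ne 0,\qquad \phi\!\left(-\frac{nb+q}{2na+p}\right)\ne 0,\qquad\forall n\in\mathbb{N}_0 .$$ Then there exists a regular functional $\mathbf{v}\in\mathcal{P}'$ such that $\mathbf{u}\sim\mathbf{v}$ and $D(\Phi\mathbf{v})=\Psi\mathbf{v}$, where $(\Phi,\Psi)$ is one of the four canonical pairs (Hermite, Laguerre, Jacobi, Bessel). More precisely, setting $\Delta=b^2-4ac$ and, if $a\neq0$, $d=\psi\left(-\frac{b}{2a}\right)$, the following holds (equalities with canonical functionals being understood up to a nonzero constant factor): 1. (Hermite) If $a=b=0$, then $\mathbf{v}=\big(\bm{h}_{\sqrt{-p/(2c)}}\circ\bm{\tau}_{q/p}\big)\mathbf{u}=\mathbf{u}_H$. 2. (Laguerre) If $a=0$ and $b\neq 0$, then $\mathbf{v}=\big(\bm{h}_{-p/b}\circ\bm{\tau}_{c/b}\big)\mathbf{u}=\mathbf{u}_L^{(\alpha)}$, with $\alpha=-1+(qb-pc)/b^2$. 3. (Bessel) If $a\ne 0$ and $\Delta=0$, then $\mathbf{v}=\big(\bm{h}_{2a/d}\circ\bm{\tau}_{b/(2a)}\big)\mathbf{u}=\mathbf{u}_B^{(\alpha)}$, with $\alpha=-2+p/a$. 4. (Jacobi) If $a\neq 0$ and $\Delta\neq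 0$, then $\mathbf{v}=\big(\bm{h}_{-2a/\sqrt{\Delta}}\circ\bm{\tau}_{b/(2a)}\big)\mathbf{u}=\mathbf{u}_J^{(\alpha,\beta)}$, with $\alpha=-1+p/(2a)-d/\sqrt{\Delta}$ and $\beta=-1+p/(2a)+d/\sqrt{\Delta}$.
   Context: $\mathcal{P}=\mathbb{C}[x]$, and $\mathcal{P}'$ is the space of all linear functionals $\mathbf{u}:\mathcal{P}\to\mathbb{C}$, with action $\langle\mathbf{u},p\rangle$. $\mathbb{N}=\{1,2,\dots\}$, $\mathbb{N}_0=\mathbb{N}\cup\{0\}$. For $\phi\in\mathcal{P}$: $\langle\phi\mathbf{u},p\rangle=\langle\mathbf{u},\phi p\rangle$, $\langle D\mathbf{u},p\rangle=-\langle\mathbf{u},p'\rangle$. For $B\in\mathbb{C}$ and $A\in\mathbb{C}\setminus\{0\}$, the operators $\bm{\tau}_B,\bm{h}_A:\mathcal{P}'\to\mathcal{P}'$ are defined by $\langle\bm{\tau}_B\mathbf{u},p\rangle=\langle\mathbf{u},p(x+B)\rangle$ and $\langle\bm{h}_A\mathbf{u},p\rangle=\langle\mathbf{u},p(Ax)\rangle$. The equivalence relation $\sim$ on $\mathcal{P}'$: $\mathbf{u}\sim\mathbf{v}$ iff there exist $A\in\mathbb{C}\setminus\{0\}$, $B\in\mathbb{C}$ with $\mathbf{v}=(\bm{h}_{A^{-1}}\circ\bm{\tau}_{-B})\mathbf{u}$. $\mathbf{u}$ is regular if there is a sequence of polynomials $P_n$ with $\deg P_n=n$ and $\langle\mathbf{u},P_mP_n\rangle=\kappa_n\delta_{m,n}$,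 $\kappa_n\ne0$. $\mathbf{u}$ is classical if it is regular and $D(\phi\mathbf{u})=\psi\mathbf{u}$ for some polynomials with $\deg\phi\le2$, $\deg\psi=1$. Canonical pairs and functionals: $\mathbf{u}_H,\mathbf{u}_L^{(\alpha)},\mathbf{u}_J^{(\alpha,\beta)},\mathbf{u}_B^{(\alpha)}$ denote the regular functionals $\mathbf{w}$ satisfying $D(\Phi\mathbf{w})=\Psi\mathbf{w}$ with, respectively: Hermite: $\Phi=1$, $\Psi=-2x$ (no condition); Laguerre: $\Phi=x$, $\Psi=-x+\alpha+1$, with $-\alpha\notin\mathbb{N}$; Jacobi: $\Phi=1-x^2$, $\Psi=-(\alpha+\beta+2)x+\beta-\alpha$, with $-\alpha,-\beta,-(\alpha+\beta+1)\notin\mathbb{N}$; Bessel: $\Phi=x^2$, $\Psi=(\alpha+2)x+2$, with $-(\alpha+1)\notin\mathbb{N}$. Each is determined by its equation up to a nonzero constant factor (its zeroth moment). Complex square roots denote any fixed choice of square root (the same one throughout a given case). *)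

theory Defs
  imports Complex_Main "HOL-Computational_Algebra.Polynomial"
begin

text \<open>The algebraic dual of the space of complex polynomials (no continuity is required).\<close>

definition poly_dual :: "(complex poly \<Rightarrow> complex) set" where
  "poly_dual = {u. Vector_Spaces.linear smult (*) u}"

lemma poly_dual_iff:
  "u \<in> poly_dual \<longleftrightarrow>
     (\<forall>f g. u (f + g) = u f + u g) \<and> (\<forall>k f. u (smult k f) = k * u f)"
proof -
  have "vector_space (smult :: complex \<Rightarrow> complex poly \<Rightarrow> complex poly)"
    by unfold_locales (simp_all add: smult_add_left smult_add_right)
  moreover have "vector_space ((*) :: complex \<Rightarrow> complex \<Rightarrow> complex)"
    by unfold_locales (simp_all add: algebra_simps)
  ultimately show ?thesis
    by (simp add: poly_dual_def Vector_Spaces.linear_def module_hom_def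
        module_hom_axioms_def module_iff_vector_space)
qed

definition poly_times :: "complex poly \<Rightarrow> (complex poly \<Rightarrow> complex) \<Rightarrow> complex poly \<Rightarrow> complex" where
  "poly_times \<phi> u = (\<lambda>f. u (\<phi> * f))"

definition fderiv :: "(complex poly \<Rightarrow> complex) \<Rightarrow> complex poly \<Rightarrow> complex" where
  "fderiv u = (\<lambda>f. - u (pderiv f))"

definition ftranslate :: "complex \<Rightarrow> (complex poly \<Rightarrow> complex) \<Rightarrow> complex poly \<Rightarrow> complex" where
  "ftranslate B u = (\<lambda>f. u (pcompose f [:B, 1:]))"

text \<open>The dilation is only meaningful for a nonzero factor.\<close>

definition fdilate :: "complex \<Rightarrow> (complex poly \<Rightarrow> complex) \<Rightarrow> complex poly \<Rightarrow> complex" where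
  "fdilate A u = (\<lambda>f. u (pcompose f [:0, A:]))"

definition affine_equiv :: "(complex poly \<Rightarrow> complex) \<Rightarrow> (complex poly \<Rightarrow> complex) \<Rightarrow> bool" where
  "affine_equiv u v \<longleftrightarrow>
     (\<exists>A B. A \<noteq> 0 \<and> v = (fdilate (inverse A) \<circ> ftranslate (- B)) u)"

text \<open>
  The convention \<open>degree 0 = 0\<close> is harmless here: \<open>\<kappa> 0 \<noteq> 0\<close> forces \<open>P 0 \<noteq> 0\<close>.
\<close>

definition regular :: "(complex poly \<Rightarrow> complex) \<Rightarrow> bool" where
  "regular u \<longleftrightarrow> u \<in> poly_dual \<and>
     (\<exists>(P :: nat \<Rightarrow> complex poly) (\<kappa> :: nat \<Rightarrow> complex).
        (\<forall>n. degree (P n) = n) \<and> (\<forall>n. \<kappa> n \<noteq> 0) \<and>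
        (\<forall>m n. u (P m * P n) = (if m = n then \<kappa> n else 0)))"

definition pearson :: "complex poly \<Rightarrow> complex poly \<Rightarrow> (complex poly \<Rightarrow> complex) \<Rightarrow> bool" where
  "pearson \<phi> \<psi> u \<longleftrightarrow> fderiv (poly_times \<phi> u) = poly_times \<psi> u"

definition classical :: "(complex poly \<Rightarrow> complex) \<Rightarrow> bool" where
  "classical u \<longleftrightarrow> regular u \<and>
     (\<exists>\<phi> \<psi>. degree \<phi> \<le> 2 \<and> degree \<psi> = 1 \<and> pearson \<phi> \<psi> u)"

definition hermite_pair :: "complex poly \<times> complex poly" where
  "hermite_pair = ([:1:], [:0, - 2:])"

definition laguerre_pair :: "complex \<Rightarrow> complex poly \<times> complex poly" where
  "laguerre_pair \<alpha> = ([:0, 1:], [:\<alpha> + 1, - 1:])"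

definition jacobi_pair :: "complex \<Rightarrow> complex \<Rightarrow> complex poly \<times> complex poly" where
  "jacobi_pair \<alpha> \<beta> = ([:1, 0, - 1:], [:\<beta> - \<alpha>, - (\<alpha> + \<beta> + 2):])"

definition bessel_pair :: "complex \<Rightarrow> complex poly \<times> complex poly" where
  "bessel_pair \<alpha> = ([:0, 0, 1:], [:2, \<alpha> + 2:])"

text \<open>\<open>\<nat>\<close> contains \<open>0\<close>, which has to be excluded in the parameter conditions.\<close>

definition laguerre_ok :: "complex \<Rightarrow> bool" where
  "laguerre_ok \<alpha> \<longleftrightarrow> - \<alpha> \<notin> \<nat> - {0}"

definition jacobi_ok :: "complex \<Rightarrow> complex \<Rightarrow> bool" where
  "jacobi_ok \<alpha> \<beta> \<longleftrightarrow>
     - \<alpha> \<notin> \<nat> - {0} \<and> - \<beta> \<notin> \<nat> - {0} \<and> - (\<alpha> + \<beta> + 1) \<notin> \<nat> - {0}"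

definition bessel_ok :: "complex \<Rightarrow> bool" where
  "bessel_ok \<alpha> \<longleftrightarrow> - (\<alpha> + 1) \<notin> \<nat> - {0}"

inductive canonical_pair :: "complex poly \<times> complex poly \<Rightarrow> bool" where
  hermite: "canonical_pair hermite_pair"
| laguerre: "laguerre_ok \<alpha> \<Longrightarrow> canonical_pair (laguerre_pair \<alpha>)"
| jacobi: "jacobi_ok \<alpha> \<beta> \<Longrightarrow> canonical_pair (jacobi_pair \<alpha> \<beta>)"
| bessel: "bessel_ok \<alpha> \<Longrightarrow> canonical_pair (bessel_pair \<alpha>)"

text \<open>
  A regular functional satisfying a canonical equation is determined up to its zeroth moment,
  which is nonzero; the representative with zeroth moment \<open>1\<close> is singled out.
\<close>

definition canonical_functional :: "complex poly \<times> complex poly \<Rightarrow> complex poly \<Rightarrow> complex" where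
  "canonical_functional \<Pi> = (THE w. regular w \<and> pearson (fst \<Pi>) (snd \<Pi>) w \<and> w 1 = 1)"

definition u_Hermite :: "complex poly \<Rightarrow> complex" where
  "u_Hermite = canonical_functional hermite_pair"

definition u_Laguerre :: "complex \<Rightarrow> complex poly \<Rightarrow> complex" where
  "u_Laguerre \<alpha> = canonical_functional (laguerre_pair \<alpha>)"

definition u_Jacobi :: "complex \<Rightarrow> complex \<Rightarrow> complex poly \<Rightarrow> complex" where
  "u_Jacobi \<alpha> \<beta> = canonical_functional (jacobi_pair \<alpha> \<beta>)"

definition u_Bessel :: "complex \<Rightarrow> complex poly \<Rightarrow> complex" where
  "u_Bessel \<alpha> = canonical_functional (bessel_pair \<alpha>)"

definition eq_up_to_factor :: "(complex poly \<Rightarrow> complex) \<Rightarrow> (complex poly \<Rightarrow> complex) \<Rightarrow> bool" where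
  "eq_up_to_factor v w \<longleftrightarrow> (\<exists>k. k \<noteq> 0 \<and> v = (\<lambda>f. k * w f))"

end

theory Submission imports Defs begin

text \<open>
  If \<open>\<phi>\<close> and \<open>\<psi>\<close> are the multiples \<open>k \<Phi>(L x)\<close> and \<open>k A \<Psi>(L x)\<close> for an affine map \<open>L x = A (x + B)\<close>,
  then the push-forward of \<open>u\<close> along \<open>L\<close> satisfies the equation with data \<open>\<Phi>, \<Psi>\<close>; the four cases
  only differ in the choice of \<open>L\<close>, which moves the zeros of \<open>\<phi>\<close> to their canonical positions.
  The equation gives a recurrence for the moments whose leading coefficient is
  \<open>n a + p \<noteq> 0\<close>, so its solutions are determined by the zeroth moment.
\<close>

section \<open>Linear functionals, moments and rescaling\<close>

lemma poly_dual_add: "u \<in> poly_dual \<Longrightarrow> u (f + g) = u f + u g"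
  by (simp add: poly_dual_iff)

lemma poly_dual_smult: "u \<in> poly_dual \<Longrightarrow> u (smult k f) = k * u f"
  by (simp add: poly_dual_iff)

lemma poly_dual_0: "u \<in> poly_dual \<Longrightarrow> u 0 = 0"
  using poly_dual_smult[of u 0 0] by simp

lemma poly_dual_sum: "u \<in> poly_dual \<Longrightarrow> u (\<Sum>i\<in>I. f i) = (\<Sum>i\<in>I. u (f i))"
  by (induction I rule: infinite_finite_induct) (simp_all add: poly_dual_0 poly_dual_add)

lemma poly_dual_eqI:
  assumes "u \<in> poly_dual" "w \<in> poly_dual" and "\<And>n. u (monom 1 n) = w (monom 1 n)"
  shows "u = w"
proof
  fix f :: "complex poly"
  have "f = (\<Sum>i\<le>degree f. smult (coeff f i) (monom 1 i))"
    by (simp add: smult_monom poly_as_sum_of_monoms)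
  then show "u f = w f"
    using assms by (metis (no_types, lifting) poly_dual_sum poly_dual_smult sum.cong)
qed

lemma poly_dual_mult_const: "u \<in> poly_dual \<Longrightarrow> (\<lambda>f. k * u f) \<in> poly_dual"
  by (simp add: poly_dual_iff algebra_simps)

lemma pearson_iff: "pearson \<phi> \<psi> u \<longleftrightarrow> (\<forall>f. - u (\<phi> * pderiv f) = u (\<psi> * f))"
  by (auto simp: pearson_def fderiv_def poly_times_def fun_eq_iff)

lemma pearson_mult_const: "pearson \<phi> \<psi> u \<Longrightarrow> pearson \<phi> \<psi> (\<lambda>f. k * u f)"
  unfolding pearson_iff by (metis mult_minus_right)

lemma regular_mult_const:
  assumes "regular u" "k \<noteq> 0"
  shows "regular (\<lambda>f. k * u f)"
proof -
  obtain P \<kappa> where P: "\<And>n. degree (P n) = n" "\<And>n::nat. \<kappa> n \<noteq> 0"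
    "\<And>m n. u (P m * P n) = (if m = n then \<kappa> n else 0)" and u: "u \<in> poly_dual"
    using assms(1) unfolding regular_def by blast
  show ?thesis
    unfolding regular_def
    using P u assms(2)
    by (intro conjI exI[of _ P] exI[of _ "\<lambda>n. k * \<kappa> n"]) (simp_all add: poly_dual_mult_const)
qed

text \<open>\<open>P 0\<close> is a constant \<open>x\<close>, so \<open>u (P 0 * P 0)\<close> is
  \<open>x * x\<close> times \<open>u 1\<close>; since this is \<open>\<kappa> 0\<close>,
  \<open>u 1\<close> cannot vanish. This permits normalising by the zeroth moment.\<close>

lemma regular_moment_0:
  assumes "regular u"
  shows "u 1 \<noteq> 0"
proof -
  obtain P \<kappa> where "\<And>n. degree (P n) = n" "\<And>n::nat. \<kappa> n \<noteq> 0"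
    "\<And>m n. u (P m * P n) = (if m = n then \<kappa> n else 0)" and u: "u \<in> poly_dual"
    using assms unfolding regular_def by blast
  then have P: "degree (P 0) = 0" "u (P 0 * P 0) \<noteq> 0"
    by simp_all
  obtain x where "P 0 = [:x:]"
    using P(1) by (rule degree_eq_zeroE)
  then have "P 0 * P 0 = smult (x * x) 1"
    by simp
  then show ?thesis
    using P u by (metis poly_dual_smult mult_zero_right)
qed

section \<open>The moment recurrence and uniqueness\<close>

lemma pearson_monom:
  fixes a b c p q :: complex
  shows "[:c, b, a:] * pderiv (monom 1 n) + [:q, p:] * monom 1 n =
    monom (of_nat n * a + p) (Suc n) + monom (of_nat n * b + q) n + monom (of_nat n * c) (n - 1)"
  by (cases n; simp add: poly_eq_poly_eq_iff[symmetric] fun_eq_iff poly_monom pderiv_monom)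
    (simp_all add: algebra_simps)

text \<open>The recurrence can be solved for its highest moment because
  \<open>of_nat n * a + p\<close> never vanishes, so all moments follow from
  \<open>u 1\<close>.\<close>

lemma pearson_unique:
  fixes a b c p q :: complex
  assumes u: "u \<in> poly_dual" "pearson [:c, b, a:] [:q, p:] u"
    and w: "w \<in> poly_dual" "pearson [:c, b, a:] [:q, p:] w"
    and nz: "\<And>n::nat. of_nat n * a + p \<noteq> 0" and eq: "u 1 = w 1"
  shows "u = w"
proof (rule poly_dual_eqI[OF u(1) w(1)])
  \<comment> \<open>Testing the equation on the monomial of degree \<open>n\<close> gives the
    recurrence. At \<open>n = 0\<close> the truncated index \<open>n - 1\<close> is harmless, its
    coefficient \<open>of_nat n * c\<close> being zero.\<close>
  have rec: "(of_nat n * a + p) * z (monom 1 (Suc n)) =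
      - (of_nat n * b + q) * z (monom 1 n) - of_nat n * c * z (monom 1 (n - 1))"
    if z: "z \<in> poly_dual" "pearson [:c, b, a:] [:q, p:] z" for z n
  proof -
    have "0 = z ([:c, b, a:] * pderiv (monom 1 n) + [:q, p:] * monom 1 n)"
      using z by (simp only: poly_dual_add pearson_iff) (metis add.right_inverse)
    also have "\<dots> = z (smult (of_nat n * a + p) (monom 1 (Suc n)) + smult (of_nat n * b + q) (monom 1 n)
        + smult (of_nat n * c) (monom 1 (n - 1)))"
      by (simp only: pearson_monom smult_monom mult_1_right)
    finally show ?thesis
      by (simp only: poly_dual_add[OF z(1)] poly_dual_smult[OF z(1)]) (simp add: algebra_simps eq_neg_iff_add_eq_0)
  qed
  fix n
  show "u (monom 1 n) = w (monom 1 n)"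
  proof (induction n rule: less_induct)
    case (less n)
    show ?case
    proof (cases n)
      case 0
      then show ?thesis using eq by simp
    next
      case (Suc m)
      have "u (monom 1 m) = w (monom 1 m)" "u (monom 1 (m - 1)) = w (monom 1 (m - 1))"
        using less Suc by simp_all
      then have "(of_nat m * a + p) * u (monom 1 (Suc m)) = (of_nat m * a + p) * w (monom 1 (Suc m))"
        using rec[OF u] rec[OF w] by simp
      then show ?thesis
        using nz[of m] Suc by simp
    qed
  qed
qed

text \<open>The definite description in \<open>canonical_functional\<close> needs a solution and its
  uniqueness. The solution is \<open>v\<close> itself divided by \<open>v 1\<close>; uniqueness is
  the moment recurrence. No separate construction of the canonical functionals is involved.\<close>

lemma eq_up_to_factor_canonical:
  fixes a b c p q :: complex
  assumes v: "regular v" "pearson [:c, b, a:] [:q, p:] v"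
    and nz: "\<And>n::nat. of_nat n * a + p \<noteq> 0"
  shows "eq_up_to_factor v (canonical_functional ([:c, b, a:], [:q, p:]))"
proof -
  define w where "w = (\<lambda>f. inverse (v 1) * v f)"
  have v1: "v 1 \<noteq> 0"
    using v(1) by (rule regular_moment_0)
  have w: "regular w" "pearson [:c, b, a:] [:q, p:] w" "w 1 = 1"
    unfolding w_def using v v1 by (simp_all add: regular_mult_const pearson_mult_const)
  have "canonical_functional ([:c, b, a:], [:q, p:]) = w"
    unfolding canonical_functional_def fst_conv snd_conv
  proof (rule the_equality)
    fix w' assume "regular w' \<and> pearson [:c, b, a:] [:q, p:] w' \<and> w' 1 = 1"
    then show "w' = w"
      using w nz by (intro pearson_unique[of w' c b a q p w]) (simp_all add: regular_def)
  qed (use w in blast)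
  then show ?thesis
    unfolding eq_up_to_factor_def w_def using v1
    by (intro exI[of _ "v 1"]) (simp add: mult.assoc[symmetric])
qed

section \<open>Affine changes of variable\<close>

lemma fdilate_ftranslate: "(fdilate A \<circ> ftranslate B) u f = u (pcompose f [:A * B, A:])"
  by (simp add: fdilate_def ftranslate_def pcompose_assoc[symmetric] pcompose_pCons algebra_simps)

lemma affine_equiv_fdilate_ftranslate:
  "A \<noteq> 0 \<Longrightarrow> affine_equiv u ((fdilate A \<circ> ftranslate B) u)"
  unfolding affine_equiv_def by (rule exI[of _ "inverse A"], rule exI[of _ "- B"]) simp

text \<open>Composing the orthogonal polynomials with the inverse map \<open>?M\<close> of x -> A (x
  + B) keeps degrees, and the push-forward undoes this composition, so the same
  \<open>\<kappa>\<close> serves.\<close>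

lemma regular_fdilate_ftranslate:
  assumes "regular u" "A \<noteq> 0"
  shows "regular ((fdilate A \<circ> ftranslate B) u)"
proof -
  obtain P \<kappa> where P: "\<And>n. degree (P n) = n" "\<And>n::nat. \<kappa> n \<noteq> 0"
    "\<And>m n. u (P m * P n) = (if m = n then \<kappa> n else 0)" and u: "u \<in> poly_dual"
    using assms(1) unfolding regular_def by blast
  let ?M = "[:- B, inverse A:]"
  have inv: "pcompose (pcompose f ?M) [:A * B, A:] = f" for f
  proof -
    have "pcompose ?M [:A * B, A:] = [:0, 1:]"
      using assms(2) by (simp add: pcompose_pCons field_simps)
    then show ?thesis
      by (simp add: pcompose_assoc[symmetric] pcompose_idR)
  qed
  show ?thesis
    unfolding regular_def
  proof (intro conjI exI[of _ "\<lambda>n. pcompose (P n) ?M"] exI[of _ \<kappa>] allI)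
    show "(fdilate A \<circ> ftranslate B) u \<in> poly_dual"
      using u by (simp add: poly_dual_iff fdilate_ftranslate pcompose_add pcompose_smult del: o_apply)
    show "degree (pcompose (P n) ?M) = n" for n
      using P assms(2) by (simp add: degree_pcompose)
    show "(fdilate A \<circ> ftranslate B) u (pcompose (P m) ?M * pcompose (P n) ?M) =
        (if m = n then \<kappa> n else 0)" for m n
      using P(3) by (simp add: fdilate_ftranslate pcompose_mult inv del: o_apply)
  qed (rule P(2))
qed

text \<open>The chain rule puts a factor \<open>A\<close> on the derivative side; the extra
  \<open>A\<close> in the multiple of \<open>\<Psi>\<close> balances it, and \<open>k * A\<close>
  cancels.\<close>

lemma pearson_fdilate_ftranslate:
  assumes u: "u \<in> poly_dual" "pearson (smult k (pcompose \<Phi> [:A * B, A:]))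
      (smult (k * A) (pcompose \<Psi> [:A * B, A:])) u"
    and nz: "A \<noteq> 0" "k \<noteq> 0"
  shows "pearson \<Phi> \<Psi> ((fdilate A \<circ> ftranslate B) u)"
  unfolding pearson_iff fdilate_ftranslate
proof
  fix f
  let ?L = "[:A * B, A:]"
  have "pderiv (pcompose f ?L) = smult A (pcompose (pderiv f) ?L)"
    by (simp add: pderiv_pcompose pderiv_pCons)
  then have "smult k (pcompose \<Phi> ?L) * pderiv (pcompose f ?L) = smult (k * A) (pcompose (\<Phi> * pderiv f) ?L)"
    by (simp add: pcompose_mult ac_simps)
  moreover have "smult (k * A) (pcompose \<Psi> ?L) * pcompose f ?L = smult (k * A) (pcompose (\<Psi> * f) ?L)"
    by (simp add: pcompose_mult)
  ultimately have "- (k * A * u (pcompose (\<Phi> * pderiv f) ?L)) = k * A * u (pcompose (\<Psi> * f) ?L)"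
    using u by (metis pearson_iff poly_dual_smult)
  then show "- u (pcompose (\<Phi> * pderiv f) ?L) = u (pcompose (\<Psi> * f) ?L)"
    using nz by (metis mult_cancel_left mult_minus_right no_zero_divisors)
qed

text \<open>Common core of the four cases: each has only to supply \<open>A\<close>,
  \<open>B\<close>, \<open>k\<close> and check two polynomial identities.\<close>

lemma canonical_reduction:
  fixes a b c p q a' b' c' p' q' :: complex
  assumes u: "regular u" "pearson [:c, b, a:] [:q, p:] u"
    and nz: "\<And>n::nat. of_nat n * a + p \<noteq> 0" "A \<noteq> 0" "k \<noteq> 0"
    and \<phi>: "[:c, b, a:] = smult k (pcompose [:c', b', a':] [:A * B, A:])"
    and \<psi>: "[:q, p:] = smult (k * A) (pcompose [:q', p':] [:A * B, A:])"
    and v: "v = (fdilate A \<circ> ftranslate B) u"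
  shows "regular v" "affine_equiv u v" "pearson [:c', b', a':] [:q', p':] v"
    "eq_up_to_factor v (canonical_functional ([:c', b', a':], [:q', p':]))"
proof -
  show reg: "regular v"
    unfolding v using u(1) nz(2) by (rule regular_fdilate_ftranslate)
  show "affine_equiv u v"
    unfolding v using nz(2) by (rule affine_equiv_fdilate_ftranslate)
  show pea: "pearson [:c', b', a':] [:q', p':] v"
    unfolding v using u nz \<phi> \<psi> by (intro pearson_fdilate_ftranslate[of u k]) (simp_all add: regular_def)
  \<comment> \<open>Comparing leading coefficients carries the nonvanishing of
    \<open>of_nat n * a + p\<close> over to the canonical data, as uniqueness there
    requires.\<close>
  have "a = k * A^2 * a'" "p = k * A^2 * p'"
    using \<phi> \<psi> by (simp_all add: pcompose_pCons power2_eq_square)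
  then have "of_nat n * a + p = k * A^2 * (of_nat n * a' + p')" for n
    by (simp add: algebra_simps)
  then have "of_nat n * a' + p' \<noteq> 0" for n
    using nz(1)[of n] by force
  then show "eq_up_to_factor v (canonical_functional ([:c', b', a':], [:q', p':]))"
    using reg pea by (intro eq_up_to_factor_canonical)
qed

text \<open>Positive naturals are written \<open>m + 1\<close>, which turns the parameter conditions
  into the indexed form of the regularity conditions.\<close>

lemma uminus_notin_pos_Nats:
  fixes x :: complex
  assumes "\<And>m::nat. of_nat m + 1 + x \<noteq> 0"
  shows "- x \<notin> \<nat> - {0}"
proof
  assume "- x \<in> \<nat> - {0}"
  then obtain n where n: "- x = of_nat n" "n \<noteq> 0"
    by (metis DiffE Nats_cases insertI1 of_nat_0)
  then obtain m where "n = Suc m"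
    using not0_implies_Suc by blast
  then have "of_nat m + 1 = - x"
    using n by simp
  then show False
    using assms[of m] by simp
qed

section \<open>The four canonical cases\<close>

theorem theorem3p2:
  fixes u :: "complex poly \<Rightarrow> complex"
    and a b c p q \<Delta> d r s :: complex
    and \<phi> \<psi> :: "complex poly"
  assumes "classical u"
    and "\<phi> = [:c, b, a:]" and "\<psi> = [:q, p:]"
    and "pearson \<phi> \<psi> u"
    and "\<And>n::nat. of_nat n * a + p \<noteq> 0"
    and "\<And>n::nat. poly \<phi> (- ((of_nat n * b + q) / (2 * of_nat n * a + p))) \<noteq> 0"
    and "\<Delta> = b\<^sup>2 - 4 * a * c"
    and "a \<noteq> 0 \<Longrightarrow> d = poly \<psi> (- (b / (2 * a)))"
    and "a = 0 \<and> b = 0 \<Longrightarrow> r\<^sup>2 = - p / (2 * c)"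
    and "s\<^sup>2 = \<Delta>"
  shows "\<exists>v \<Phi> \<Psi>. regular v \<and> affine_equiv u v \<and> canonical_pair (\<Phi>, \<Psi>) \<and> pearson \<Phi> \<Psi> v \<and>
    (a = 0 \<and> b = 0 \<longrightarrow>
       c \<noteq> 0 \<and>
       (\<Phi>, \<Psi>) = hermite_pair \<and>
       v = (fdilate r \<circ> ftranslate (q / p)) u \<and>
       eq_up_to_factor v u_Hermite) \<and>
    (a = 0 \<and> b \<noteq> 0 \<longrightarrow>
       (let \<alpha> = - 1 + (q * b - p * c) / b\<^sup>2 in
          laguerre_ok \<alpha> \<and>
          (\<Phi>, \<Psi>) = laguerre_pair \<alpha> \<and>
          v = (fdilate (- p / b) \<circ> ftranslate (c / b)) u \<and>
          eq_up_to_factor v (u_Laguerre \<alpha>))) \<and>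
    (a \<noteq> 0 \<and> \<Delta> = 0 \<longrightarrow>
       d \<noteq> 0 \<and>
       (let \<alpha> = - 2 + p / a in
          bessel_ok \<alpha> \<and>
          (\<Phi>, \<Psi>) = bessel_pair \<alpha> \<and>
          v = (fdilate (2 * a / d) \<circ> ftranslate (b / (2 * a))) u \<and>
          eq_up_to_factor v (u_Bessel \<alpha>))) \<and>
    (a \<noteq> 0 \<and> \<Delta> \<noteq> 0 \<longrightarrow>
       (let \<alpha> = - 1 + p / (2 * a) - d / s; \<beta> = - 1 + p / (2 * a) + d / s in
          jacobi_ok \<alpha> \<beta> \<and>
          (\<Phi>, \<Psi>) = jacobi_pair \<alpha> \<beta> \<and>
          v = (fdilate (- 2 * a / s) \<circ> ftranslate (b / (2 * a))) u \<and>
          eq_up_to_factor v (u_Jacobi \<alpha> \<beta>)))"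
proof -
  have reg: "regular u"
    using assms(1) by (simp add: classical_def)
  have pea: "pearson [:c, b, a:] [:q, p:] u"
    using assms(2-4) by simp
  note nz = assms(5)
  have p: "p \<noteq> 0"
    using nz[of 0] by simp
  \<comment> \<open>The even instances of the first regularity condition make the denominators of
    the test points nonzero.\<close>
  have nz2: "2 * of_nat n * a + p \<noteq> 0" for n :: nat
    using nz[of "2 * n"] by simp
  have root: "poly [:c, b, a:] (- ((of_nat n * b + q) / (2 * of_nat n * a + p))) \<noteq> 0" for n
    using assms(2,6) by simp
  note red = canonical_reduction[OF reg pea nz]
  consider (H) "a = 0" "b = 0" | (L) "a = 0" "b \<noteq> 0" | (B) "a \<noteq> 0" "\<Delta> = 0" | (J) "a \<noteq> 0" "\<Delta> \<noteq> 0"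
    by blast
  then show ?thesis
  proof cases
    case H
    have c: "c \<noteq> 0"
      using root[of 0] H by simp
    have r: "r\<^sup>2 = - p / (2 * c)"
      using assms(9) H by simp
    then have "r \<noteq> 0"
      using c p by auto
    \<comment> \<open>Here \<open>\<phi>\<close> is the constant \<open>c\<close>, so
      \<open>k = c\<close>; the linear coefficient of \<open>\<psi>\<close> forces
      \<open>- 2 * c * r\<^sup>2 = p\<close>. The zeros in \<open>[:1, 0, 0:]\<close> only pad to
      three coefficients.\<close>
    have \<phi>: "[:c, b, a:] = smult c (pcompose [:1, 0, 0:] [:r * (q / p), r:])"
      using H by (simp add: pcompose_pCons)
    have \<psi>: "[:q, p:] = smult (c * r) (pcompose [:0, - 2:] [:r * (q / p), r:])"
      using r c p by (simp add: pcompose_pCons power2_eq_square field_simps)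
    note red' = red[OF \<open>r \<noteq> 0\<close> c \<phi> \<psi> refl]
    have "hermite_pair = ([:1, 0, 0:], [:0, - 2:])"
      by (simp add: hermite_pair_def)
    then show ?thesis
      using H c red' canonical_pair.hermite
      by - (rule exI[of _ "(fdilate r \<circ> ftranslate (q / p)) u"], rule exI[of _ "[:1, 0, 0:]"],
        rule exI[of _ "[:0, - 2:]"], simp add: u_Hermite_def del: o_apply)
  next
    case L
    define \<alpha> where "\<alpha> = - 1 + (q * b - p * c) / b\<^sup>2"
    \<comment> \<open>At the m-th test point \<open>\<phi>\<close> takes the value
      \<open>- (b\<^sup>2 / p) * (of_nat m + 1 + \<alpha>)\<close>.\<close>
    have "of_nat m + 1 + \<alpha> \<noteq> 0" for m
      using root[of m] L p by (simp add: \<alpha>_def field_simps power2_eq_square)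
    then have ok: "laguerre_ok \<alpha>"
      unfolding laguerre_ok_def by (rule uminus_notin_pos_Nats)
    have A: "- p / b \<noteq> 0" and k: "- (b\<^sup>2 / p) \<noteq> 0"
      using L p by simp_all
    have \<phi>: "[:c, b, a:] = smult (- (b\<^sup>2 / p)) (pcompose [:0, 1, 0:] [:(- p / b) * (c / b), - p / b:])"
      using L p by (simp add: pcompose_pCons field_simps power2_eq_square)
    have \<psi>: "[:q, p:] = smult (- (b\<^sup>2 / p) * (- p / b))
        (pcompose [:\<alpha> + 1, - 1:] [:(- p / b) * (c / b), - p / b:])"
      using L p by (simp add: pcompose_pCons \<alpha>_def field_simps power2_eq_square)
    note red' = red[OF A k \<phi> \<psi> refl]
    have "laguerre_pair \<alpha> = ([:0, 1, 0:], [:\<alpha> + 1, - 1:])"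
      by (simp add: laguerre_pair_def)
    then show ?thesis
      unfolding Let_def \<alpha>_def[symmetric]
      using L ok red' canonical_pair.laguerre[OF ok]
      by - (rule exI[of _ "(fdilate (- p / b) \<circ> ftranslate (c / b)) u"], rule exI[of _ "[:0, 1, 0:]"],
        rule exI[of _ "[:\<alpha> + 1, - 1:]"], simp add: u_Laguerre_def del: o_apply)
  next
    case B
    define \<alpha> where "\<alpha> = - 2 + p / a"
    have d: "d = q - p * b / (2 * a)"
      using assms(3,8) B by simp
    have c: "c = b\<^sup>2 / (4 * a)"
      using assms(7) B by (simp add: field_simps)
    \<comment> \<open>\<open>\<phi>\<close> has the double root \<open>- b / (2 * a)\<close>, and
      \<open>d\<close> is the value of \<open>\<psi>\<close> there. If \<open>d\<close> were zero,
      the zero \<open>- q / p\<close> of \<open>\<psi>\<close>, which is the test point for index 0,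
      would be that root.\<close>
    have "d \<noteq> 0"
    proof
      assume "d = 0"
      then have "- (q / p) = - b / (2 * a)"
        using d p B by (simp add: field_simps)
      then show False
        using root[of 0] B c by (simp add: power2_eq_square)
    qed
    have "of_nat m + 1 + (\<alpha> + 1) \<noteq> 0" for m
      using nz[of m] B by (simp add: \<alpha>_def field_simps)
    then have ok: "bessel_ok \<alpha>"
      unfolding bessel_ok_def by (rule uminus_notin_pos_Nats)
    have A: "2 * a / d \<noteq> 0" and k: "d\<^sup>2 / (4 * a) \<noteq> 0"
      using B \<open>d \<noteq> 0\<close> by simp_all
    have \<phi>: "[:c, b, a:] = smult (d\<^sup>2 / (4 * a))
        (pcompose [:0, 0, 1:] [:(2 * a / d) * (b / (2 * a)), 2 * a / d:])"
      using B \<open>d \<noteq> 0\<close> c by (simp add: pcompose_pCons field_simps power2_eq_square)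
    \<comment> \<open>Expanding \<open>\<psi>\<close> around the double root gives the constant term
      \<open>d\<close>, which the scale \<open>2 * a / d\<close> turns into the canonical 2.\<close>
    have q: "q = d + p * b / (2 * a)"
      using d by simp
    have \<psi>: "[:q, p:] = smult (d\<^sup>2 / (4 * a) * (2 * a / d))
        (pcompose [:2, \<alpha> + 2:] [:(2 * a / d) * (b / (2 * a)), 2 * a / d:])"
      unfolding q using B \<open>d \<noteq> 0\<close>
      by (simp add: pcompose_pCons \<alpha>_def field_simps power2_eq_square)
    note red' = red[OF A k \<phi> \<psi> refl]
    have "bessel_pair \<alpha> = ([:0, 0, 1:], [:2, \<alpha> + 2:])"
      by (simp add: bessel_pair_def)
    then show ?thesis
      unfolding Let_def \<alpha>_def[symmetric]
      using B \<open>d \<noteq> 0\<close> ok red' canonical_pair.bessel[OF ok]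
      by - (rule exI[of _ "(fdilate (2 * a / d) \<circ> ftranslate (b / (2 * a))) u"], rule exI[of _ "[:0, 0, 1:]"],
        rule exI[of _ "[:2, \<alpha> + 2:]"], simp add: u_Bessel_def del: o_apply)
  next
    case J
    define \<alpha> where "\<alpha> = - 1 + p / (2 * a) - d / s"
    define \<beta> where "\<beta> = - 1 + p / (2 * a) + d / s"
    have d: "d = q - p * b / (2 * a)"
      using assms(3,8) J by simp
    have q: "q = d + p * b / (2 * a)"
      using d by simp
    have s: "s \<noteq> 0"
      using J assms(10) by auto
    have c: "c = (b\<^sup>2 - s\<^sup>2) / (4 * a)"
      using assms(7,10) J by (simp add: field_simps)
    \<comment> \<open>Stated for either square root \<open>t\<close> of \<Delta>:
      \<open>t = - s\<close> yields the condition on \<alpha> and \<open>t = s\<close> the one on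
      \<beta>. If the sum vanished, the m-th test point would be the root
      \<open>(t - b) / (2 * a)\<close> of \<open>\<phi>\<close>.\<close>
    have cond: "of_nat m + p / (2 * a) + d / t \<noteq> 0" if t: "t\<^sup>2 = s\<^sup>2" for m t
    proof
      assume eq: "of_nat m + p / (2 * a) + d / t = 0"
      have "t \<noteq> 0"
        using t s by auto
      then have "t / (2 * a) = - d / (2 * of_nat m * a + p)"
        using eq J nz2[of m] by (simp add: divide_simps) algebra
      also have "\<dots> = b / (2 * a) - (of_nat m * b + q) / (2 * of_nat m * a + p)"
        using J nz2[of m] unfolding q by (simp add: divide_simps) algebra
      finally have "- ((of_nat m * b + q) / (2 * of_nat m * a + p)) = (t - b) / (2 * a)"
        by (simp add: diff_divide_distrib)
      moreover have "poly [:c, b, a:] ((t - b) / (2 * a)) = 0"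
        using t J unfolding c by (simp add: divide_simps) algebra
      ultimately show False
        using root[of m] by simp
    qed
    have "of_nat m + 1 + \<alpha> \<noteq> 0" "of_nat m + 1 + \<beta> \<noteq> 0" for m
      using cond[of "- s" m] cond[of s m] by (simp_all add: \<alpha>_def \<beta>_def algebra_simps)
    \<comment> \<open>The condition on \<alpha> + \<beta> comes from the other regularity condition,
      since \<alpha> + \<beta> + 2 equals \<open>p / a\<close>.\<close>
    moreover have "of_nat m + 1 + (\<alpha> + \<beta> + 1) = (of_nat m * a + p) / a" for m
      using J by (simp add: \<alpha>_def \<beta>_def field_simps)
    then have "of_nat m + 1 + (\<alpha> + \<beta> + 1) \<noteq> 0" for m
      using nz[of m] J by simp
    ultimately have ok: "jacobi_ok \<alpha> \<beta>"
      unfolding jacobi_ok_def by (intro conjI uminus_notin_pos_Nats)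
    have A: "- 2 * a / s \<noteq> 0" and k: "- (s\<^sup>2 / (4 * a)) \<noteq> 0"
      using J s by simp_all
    \<comment> \<open>The map sends the roots \<open>(- b + s) / (2 * a)\<close> and
      \<open>(- b - s) / (2 * a)\<close> to -1 and 1; \<open>k\<close> is the value of
      \<open>\<phi>\<close> at their midpoint.\<close>
    have \<phi>: "[:c, b, a:] = smult (- (s\<^sup>2 / (4 * a)))
        (pcompose [:1, 0, - 1:] [:(- 2 * a / s) * (b / (2 * a)), - 2 * a / s:])"
      unfolding c using J s by (simp add: pcompose_pCons field_simps power2_eq_square)
    have \<psi>: "[:q, p:] = smult (- (s\<^sup>2 / (4 * a)) * (- 2 * a / s))
        (pcompose [:\<beta> - \<alpha>, - (\<alpha> + \<beta> + 2):] [:(- 2 * a / s) * (b / (2 * a)), - 2 * a / s:])"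
      unfolding q using J s
      by (simp add: pcompose_pCons \<alpha>_def \<beta>_def field_simps power2_eq_square)
    note red' = red[OF A k \<phi> \<psi> refl]
    have "jacobi_pair \<alpha> \<beta> = ([:1, 0, - 1:], [:\<beta> - \<alpha>, - (\<alpha> + \<beta> + 2):])"
      by (simp add: jacobi_pair_def)
    then show ?thesis
      unfolding Let_def \<alpha>_def[symmetric] \<beta>_def[symmetric]
      using J ok red' canonical_pair.jacobi[OF ok]
      by - (rule exI[of _ "(fdilate (- 2 * a / s) \<circ> ftranslate (b / (2 * a))) u"], rule exI[of _ "[:1, 0, - 1:]"],
        rule exI[of _ "[:\<beta> - \<alpha>, - (\<alpha> + \<beta> + 2):]"], simp add: u_Jacobi_def del: o_apply)
  qed
qed

end
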